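(* Let $n\ge 2$ and $0\le m\le n(n-1)$ be integers and let $\kappa=\lfloor \frac{m}{n-1}\rfloor$. Among all simple directed graphs with $n$ vertices and $m$ arcs, the minimum possible value of $\sigma^2$ is (attained and equal to) $$\sigma^2_{\min}=\frac{1}{(n-1)^2}\big[m-(n-1)\kappa\big]\big[(n-1)(\kappa+1)-m\big],$$ and a simple directed graph with $n$ vertices and $m$ arcs achieves $\sigma^2=\sigma^2_{\min}$ if, and only if, its Laplacian spectrum (as a multiset) consists of one eigenvalue $0$, together with $(n-1)(\kappa+1)-m$ eigenvalues equal to $\kappa$ and $m-(n-1)\kappa$ eigenvalues equal to $\kappa+1$.
   Context: A directed graph is simple if it has no self-arcs and no multiple arcs with the same tail and head (a pair of opposite arcs $(i,j)$, $(j,i)$ is allowed). An arc $(j,i)$ goes from tail $j$ to head $i$. For a simple directed graph with vertices $1,\ldots,n$, let $D$ be the diagonal matrix whose $i$th diagonal entry is the in-degree of vertex $i$, and let $A$ be the $n\times n$ matrix whose $ij$th entry is $1$ if $(j,i)$ is an arc and $0$ otherwise. The Laplacian matrix is $L=D-A$; its row sums are zero, so it has eigenvalue $0$. Its Laplacian spectrum is the multiset of eigenvalues of $L$ (with algebraic multiplicity). Write the eigenvalues as $\lambda_1=0,\lambda_2,\ldots,\lambda_n\in\mathbb{C}$. The normalized spread is $$\sigma^2=\frac{1}{n-1}\sum_{i=2}^n|\lambda_i-\bar\lambda|^2,\qquad \bar\lambda=\frac{1}{n-1}\sum_{i=2}^n\lambda_i.$$ *)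

theory Defs
  imports
    "HOL-Computational_Algebra.Polynomial"
    "Jordan_Normal_Form.Char_Poly"
    "Graph_Theory.Pair_Digraph"
begin

text \<open>
  A simple directed graph on \<open>n\<close> labelled vertices is a \<^locale>\<open>pair_digraph\<close> with vertex set
  \<open>{0..<n}\<close> (numbered from 0, like the rows and columns of matrices).  The arc \<open>(j, i)\<close> has
  tail \<open>j\<close> and head \<open>i\<close>.
\<close>

definition simple_digraphs :: "nat \<Rightarrow> nat \<Rightarrow> nat pair_pre_digraph set" where
  "simple_digraphs n m = {G. pair_digraph G \<and> pverts G = {0..<n} \<and> card (parcs G) = m}"

definition in_degree_mat :: "nat \<Rightarrow> nat pair_pre_digraph \<Rightarrow> complex mat" where
  "in_degree_mat n G =
     mat n n (\<lambda>(i, j). if i = j then of_nat (in_degree (with_proj G) i) else 0)"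

definition adjacency_mat :: "nat \<Rightarrow> nat pair_pre_digraph \<Rightarrow> complex mat" where
  "adjacency_mat n G = mat n n (\<lambda>(i, j). if (j, i) \<in> parcs G then 1 else 0)"

definition laplacian :: "nat \<Rightarrow> nat pair_pre_digraph \<Rightarrow> complex mat" where
  "laplacian n G = in_degree_mat n G - adjacency_mat n G"

definition laplacian_spectrum :: "nat \<Rightarrow> nat pair_pre_digraph \<Rightarrow> complex multiset" where
  "laplacian_spectrum n G = proots (char_poly (laplacian n G))"

text \<open>
  The rows of the Laplacian sum to zero, so 0 occurs in its spectrum; exactly one occurrence
  (the eigenvalue \<open>\<lambda>\<^sub>1\<close>) is removed to obtain \<open>\<lambda>\<^sub>2, \<dots>, \<lambda>\<^sub>n\<close>.
\<close>

definition nontrivial_spectrum :: "nat \<Rightarrow> nat pair_pre_digraph \<Rightarrow> complex multiset" where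
  "nontrivial_spectrum n G = laplacian_spectrum n G - {#0#}"

definition mean_eigenvalue :: "nat \<Rightarrow> nat pair_pre_digraph \<Rightarrow> complex" where
  "mean_eigenvalue n G = (\<Sum>z\<in>#nontrivial_spectrum n G. z) / (of_nat n - 1)"

definition normalized_spread :: "nat \<Rightarrow> nat pair_pre_digraph \<Rightarrow> real" where
  "normalized_spread n G =
     (\<Sum>z\<in>#nontrivial_spectrum n G. (cmod (z - mean_eigenvalue n G))\<^sup>2) / (real n - 1)"

end

theory Submission
  imports Defs "Jordan_Normal_Form.Schur_Decomposition"
begin

text \<open>
  The nontrivial eigenvalues are the roots of a monic integer polynomial \<open>p\<close>, and their sum is the
  trace \<open>m\<close>.  Put \<open>\<mu> = \<lambda> - \<kappa>\<close>.  Expanding the square shows that \<open>\<sigma>\<^sup>2\<close> exceeds the claimed minimum by the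
  sum of the excesses \<open>|\<mu>|\<^sup>2 - Re \<mu>\<close> divided by \<open>n - 1\<close>.  Roots with \<open>\<mu> = 0\<close> contribute nothing.  For the
  others, \<open>2 (|\<mu>|\<^sup>2 - Re \<mu>) = |\<mu> - 1|\<^sup>2 + (|\<mu>|\<^sup>2 - 1)\<close>, and since the product of the nonzero \<open>\<mu>\<close> is
  a nonzero integer, AM-GM makes the sum of the terms \<open>|\<mu>|\<^sup>2 - 1\<close> nonnegative.  Hence the total excess
  is nonnegative, and it vanishes only if every nonzero \<open>\<mu>\<close> is \<open>1\<close>.

  The minimum is attained by letting \<open>\<kappa>\<close> hubs point to all other vertices and one further vertex
  point to the remaining number of vertices: modulo the all-ones vector the Laplacian is then
  diagonal.
\<close>

subsection \<open>Excess of the roots of integer polynomials\<close>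

text \<open>Summing \<open>ln t \<le> t - 1\<close> gives AM-GM in a form without roots or a
  division by the size of \<open>S\<close>.\<close>

lemma ln_prod_mset_le:
  fixes f :: "'a \<Rightarrow> real"
  assumes "\<And>x. x \<in># S \<Longrightarrow> f x > 0"
  shows "ln (\<Prod>x\<in>#S. f x) \<le> (\<Sum>x\<in>#S. f x - 1)"
  using assms
proof (induction S)
  case (add x S)
  have "(\<Prod>x\<in>#T. f x) > 0" if "\<And>x. x \<in># T \<Longrightarrow> f x > 0" for T
    using that by (induction T) auto
  then have pos: "f x > 0" "(\<Prod>x\<in>#S. f x) > 0"
    using add.prems by auto
  have "ln (\<Prod>x\<in>#add_mset x S. f x) = ln (f x) + ln (\<Prod>x\<in>#S. f x)"
    using ln_mult_pos[OF pos] by simp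
  also have "\<dots> \<le> (f x - 1) + (\<Sum>x\<in>#S. f x - 1)"
    using pos(1) add by (intro add_mono ln_le_minus_one) auto
  finally show ?case by simp
qed simp

lemma norm_prod_mset: "norm (\<Prod>x\<in>#S. f x) = (\<Prod>x\<in>#S. norm (f x))"
  for f :: "'a \<Rightarrow> 'b :: {real_normed_field}"
  by (induction S) (auto simp: norm_mult)

text \<open>The squared moduli have product at least 1, so its logarithm is nonnegative and bounds
  the sum from below.\<close>

lemma sum_mset_norm_sq_ge_size:
  fixes f :: "'a \<Rightarrow> complex"
  assumes "norm (\<Prod>x\<in>#S. f x) \<ge> 1"
  shows "0 \<le> (\<Sum>x\<in>#S. (cmod (f x))\<^sup>2 - 1)"
proof -
  have nz: "f x \<noteq> 0" if "x \<in># S" for x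
  proof
    assume "f x = 0"
    then have "0 \<in># image_mset f S" using that by force
    then have "(\<Prod>x\<in>#S. f x) = 0" using prod_mset_zero_iff by blast
    then show False using assms by (metis norm_zero not_one_le_zero)
  qed
  have "(\<Prod>x\<in>#S. (cmod (f x))\<^sup>2) = (norm (\<Prod>x\<in>#S. f x))\<^sup>2"
    by (induction S) (auto simp: norm_mult power_mult_distrib)
  also have "\<dots> \<ge> 1" using assms by simp
  finally have "0 \<le> ln (\<Prod>x\<in>#S. (cmod (f x))\<^sup>2)" by simp
  also have "\<dots> \<le> (\<Sum>x\<in>#S. (cmod (f x))\<^sup>2 - 1)"
    using nz by (intro ln_prod_mset_le) auto
  finally show ?thesis .
qed

lemma sum_mset_nonneg_real:
  fixes f :: "'a \<Rightarrow> real"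
  assumes "\<And>x. x \<in># S \<Longrightarrow> f x \<ge> 0"
  shows "(\<Sum>x\<in>#S. f x) \<ge> 0"
  using assms by (induction S) (auto intro: add_nonneg_nonneg)

lemma sum_mset_nonneg_eq_0:
  fixes f :: "'a \<Rightarrow> real"
  assumes "\<And>x. x \<in># S \<Longrightarrow> f x \<ge> 0" "(\<Sum>x\<in>#S. f x) \<le> 0" "x \<in># S"
  shows "f x = 0"
proof -
  obtain T where T: "S = add_mset x T" using assms(3) by (meson mset_add)
  have "(\<Sum>x\<in>#T. f x) \<ge> 0"
    using assms(1) T by (intro sum_mset_nonneg_real) auto
  then show ?thesis using T assms(1)[OF assms(3)] assms(2) by simp
qed

text \<open>The square detects \<open>z = 1\<close>; the other term may be negative at a single root
  and is controlled only after summation.\<close>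

lemma double_excess_eq:
  "2 * ((cmod z)\<^sup>2 - Re z) = (cmod (z - 1))\<^sup>2 + ((cmod z)\<^sup>2 - 1)"
  unfolding cmod_power2 by (simp add: power2_eq_square algebra_simps)

text \<open>Up to sign, \<open>poly g k\<close> is the product of the differences
  \<open>z - k\<close> over the roots. Being a nonzero integer, it has modulus at least 1, so AM-GM
  applies.\<close>

lemma int_poly_excess_nonroot:
  fixes g :: "int poly" and k :: int
  assumes "lead_coeff g = 1" "poly g k \<noteq> 0"
  defines "S \<equiv> proots (map_poly of_int g :: complex poly)"
  defines "e \<equiv> (\<lambda>z. (cmod (z - of_int k))\<^sup>2 - Re (z - of_int k))"
  shows "0 \<le> (\<Sum>z\<in>#S. e z)"
    and "(\<Sum>z\<in>#S. e z) = 0 \<Longrightarrow> z \<in># S \<Longrightarrow> z = of_int k + 1"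
proof -
  let ?d = "\<lambda>z. (cmod (z - of_int k - 1))\<^sup>2"
  let ?g = "map_poly of_int g :: complex poly"
  have lc: "lead_coeff ?g = 1" using assms(1) by simp
  have "?g = (\<Prod>x\<in>#S. [:-x, 1:])"
    using complex_poly_decompose_multiset[of ?g] lc by (simp add: S_def)
  then have "poly ?g (of_int k) = (\<Prod>x\<in>#S. of_int k - x)"
    by (simp add: poly_prod_mset image_mset.compositionality o_def)
  also have "\<dots> = (\<Prod>x\<in>#S. - (x - of_int k))" by simp
  finally have "norm (\<Prod>x\<in>#S. x - of_int k) = norm (poly ?g (of_int k))"
    by (simp add: norm_prod_mset norm_minus_commute)
  also have "\<dots> = real_of_int \<bar>poly g k\<bar>"
    by simp
  also have "\<dots> \<ge> 1" using assms(2) by linarith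
  finally have amgm: "0 \<le> (\<Sum>z\<in>#S. (cmod (z - of_int k))\<^sup>2 - 1)"
    by (intro sum_mset_norm_sq_ge_size)
  have "2 * e z = ?d z + ((cmod (z - of_int k))\<^sup>2 - 1)" for z
    unfolding e_def by (rule double_excess_eq)
  then have "2 * (\<Sum>z\<in>#T. e z) = (\<Sum>z\<in>#T. ?d z) + (\<Sum>z\<in>#T. (cmod (z - of_int k))\<^sup>2 - 1)" for T
    by (induction T) (auto simp: distrib_left)
  \<comment> \<open>Keeping the squared distances to \<open>k + 1\<close> on the left settles the
    equality case too: zero total excess forces each of them to vanish.\<close>
  then have le: "(\<Sum>z\<in>#S. ?d z) \<le> 2 * (\<Sum>z\<in>#S. e z)" using amgm by (metis le_add_same_cancel1)
  moreover have "0 \<le> (\<Sum>z\<in>#S. ?d z)" by (intro sum_mset_nonneg_real) auto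
  ultimately show "0 \<le> (\<Sum>z\<in>#S. e z)" by linarith
  assume "(\<Sum>z\<in>#S. e z) = 0" "z \<in># S"
  with le have "?d z = 0" by (intro sum_mset_nonneg_eq_0[of S ?d]) auto
  then show "z = of_int k + 1" by (simp add: algebra_simps)
qed

text \<open>Splitting off the full power of \<open>[:-k, 1:]\<close> removes only roots equal to
  \<open>k\<close>, whose excess is 0. The cofactor is still monic and integral, and does not vanish
  at \<open>k\<close>.\<close>

lemma int_poly_excess:
  fixes p :: "int poly" and k :: int
  assumes "lead_coeff p = 1"
  defines "S \<equiv> proots (map_poly of_int p :: complex poly)"
  defines "e \<equiv> (\<lambda>z. (cmod (z - of_int k))\<^sup>2 - Re (z - of_int k))"
  shows "0 \<le> (\<Sum>z\<in>#S. e z)"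
    and "(\<Sum>z\<in>#S. e z) = 0 \<longleftrightarrow> (\<forall>z\<in>#S. z = of_int k \<or> z = of_int k + 1)"
proof -
  have "p \<noteq> 0" using assms(1) by auto
  then obtain g where g: "p = [:-k, 1:] ^ Polynomial.order k p * g" "\<not> [:-k, 1:] dvd g"
    using order_decomp by blast
  let ?r = "Polynomial.order k p"
  let ?T = "proots (map_poly of_int g :: complex poly)"
  have "lead_coeff p = lead_coeff g"
    using arg_cong[OF g(1), of lead_coeff] unfolding lead_coeff_mult lead_coeff_power by simp
  then have lcg: "lead_coeff g = 1" using assms(1) by simp
  then have "g \<noteq> 0" by auto
  have gk: "poly g k \<noteq> 0" using g(2) by (simp add: poly_eq_0_iff_dvd)
  have "map_poly of_int p = ([:-of_int k, 1:] ^ ?r * map_poly of_int g :: complex poly)"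
    by (subst g(1)) (simp add: of_int_poly_hom.hom_mult of_int_poly_hom.hom_power)
  moreover have "repeat_mset j {#a#} = replicate_mset j a" for j and a :: complex
    by (induction j) auto
  ultimately have S: "S = replicate_mset ?r (of_int k) + ?T"
    using \<open>g \<noteq> 0\<close> by (simp add: S_def proots_mult proots_power)
  have "e (of_int k) = 0" by (simp add: e_def)
  then have sum: "(\<Sum>z\<in>#S. e z) = (\<Sum>z\<in>#?T. e z)"
    by (simp add: S)
  note nonroot = int_poly_excess_nonroot[OF lcg gk, folded e_def]
  show "0 \<le> (\<Sum>z\<in>#S. e z)" using nonroot(1) sum by simp
  show "(\<Sum>z\<in>#S. e z) = 0 \<longleftrightarrow> (\<forall>z\<in>#S. z = of_int k \<or> z = of_int k + 1)"
  proof
    assume "(\<Sum>z\<in>#S. e z) = 0"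
    then show "\<forall>z\<in>#S. z = of_int k \<or> z = of_int k + 1"
      using nonroot(2) sum S by (auto split: if_splits)
  next
    assume "\<forall>z\<in>#S. z = of_int k \<or> z = of_int k + 1"
    then have "\<forall>z\<in>#S. e z = 0" by (auto simp: e_def)
    then show "(\<Sum>z\<in>#S. e z) = 0" by (simp cong: image_mset_cong)
  qed
qed

text \<open>The multiplicities \<open>a\<close>, \<open>b\<close> solve \<open>a + b = N\<close> and
  \<open>a * k + b * (k + 1) = m\<close>. Hence neither natural subtraction truncates.\<close>

lemma sum_two_values:
  fixes S :: "complex multiset"
  assumes "\<forall>z\<in>#S. z = of_nat k \<or> z = of_nat (k + 1)" "size S = N" "(\<Sum>z\<in>#S. z) = of_nat m"
  shows "S = replicate_mset (N * (k + 1) - m) (of_nat k) + replicate_mset (m - N * k) (of_nat (k + 1))"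
proof -
  define a where "a = count S (of_nat k)"
  define b where "b = count S (of_nat (k + 1))"
  have S: "S = replicate_mset a (of_nat k) + replicate_mset b (of_nat (k + 1))"
    using assms(1) by (intro multiset_eqI) (auto simp: a_def b_def count_eq_zero_iff)
  have N: "N = a + b" using assms(2) by (subst (asm) S) simp
  have "of_nat (a * k + b * (k + 1)) = (of_nat m :: complex)"
    using assms(3) by (subst (asm) S) (simp add: algebra_simps)
  then have m: "m = a * k + b * (k + 1)" by (simp only: of_nat_eq_iff)
  have "N * (k + 1) - m = a" "m - N * k = b" unfolding N m by (simp_all add: algebra_simps)
  with S show ?thesis by simp
qed

subsection \<open>Matrices with vanishing row sums\<close>

text \<open>The columns form a basis: the all-ones vector, followed by the unit vectors other than
  the first.\<close>

definition ones_col_mat :: "nat \<Rightarrow> 'a :: comm_ring_1 mat" where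
  "ones_col_mat n = mat n n (\<lambda>(i, j). if j = 0 \<or> i = j then 1 else 0)"

definition ones_col_mat_inv :: "nat \<Rightarrow> 'a :: comm_ring_1 mat" where
  "ones_col_mat_inv n = mat n n (\<lambda>(i, j). if i = j then 1 else if j = 0 then -1 else 0)"

text \<open>
  For a matrix with zero row sums, this represents the induced map on the quotient by the all-ones
  vector, in the basis of the images of the unit vectors other than the first.
\<close>
definition reduced_mat :: "'a :: comm_ring_1 mat \<Rightarrow> 'a mat" where
  "reduced_mat A = mat (dim_row A - 1) (dim_row A - 1)
     (\<lambda>(i, j). A $$ (Suc i, Suc j) - A $$ (0, Suc j))"

lemma ones_col_mat_carrier [simp]:
  "ones_col_mat n \<in> carrier_mat n n" "ones_col_mat_inv n \<in> carrier_mat n n"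
  "dim_row (ones_col_mat n) = n" "dim_col (ones_col_mat n) = n"
  "dim_row (ones_col_mat_inv n) = n" "dim_col (ones_col_mat_inv n) = n"
  by (simp_all add: ones_col_mat_def ones_col_mat_inv_def)

lemma index_ones_col_mat_mult:
  assumes B: "B \<in> carrier_mat n nc" and i: "i < n" and j: "j < nc"
  shows "(ones_col_mat n * B) $$ (i, j) = (if i = 0 then B $$ (0, j) else B $$ (0, j) + B $$ (i, j))"
proof -
  have "(ones_col_mat n * B) $$ (i, j) = (\<Sum>k<n. (if k = 0 \<or> i = k then 1 else 0) * B $$ (k, j))"
    using assms by (simp add: scalar_prod_def ones_col_mat_def lessThan_atLeast0)
  \<comment> \<open>For \<open>i = 0\<close> the index set is a singleton, which explains the case
    distinction in the result.\<close>
  also have "\<dots> = (\<Sum>k\<in>{0, i}. B $$ (k, j))"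
    using i by (intro sum.mono_neutral_cong_right) auto
  finally show ?thesis by auto
qed

lemma index_ones_col_mat_inv_mult:
  assumes B: "B \<in> carrier_mat n nc" and i: "i < n" and j: "j < nc"
  shows "(ones_col_mat_inv n * B) $$ (i, j) = (if i = 0 then B $$ (0, j) else B $$ (i, j) - B $$ (0, j))"
proof -
  have "(ones_col_mat_inv n * B) $$ (i, j) =
    (\<Sum>k<n. (if i = k then 1 else if k = 0 then -1 else 0) * B $$ (k, j))"
    using assms by (simp add: scalar_prod_def ones_col_mat_inv_def lessThan_atLeast0)
  also have "\<dots> = (\<Sum>k\<in>{0, i}. (if i = k then 1 else -1) * B $$ (k, j))"
    using i by (intro sum.mono_neutral_cong_right) auto
  finally show ?thesis by auto
qed

lemma index_mult_ones_col_mat: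
  assumes A: "A \<in> carrier_mat nr n" and i: "i < nr" and j: "j < n"
  shows "(A * ones_col_mat n) $$ (i, j) = (if j = 0 then \<Sum>k<n. A $$ (i, k) else A $$ (i, j))"
proof -
  have "(A * ones_col_mat n) $$ (i, j) = (\<Sum>k<n. A $$ (i, k) * (if j = 0 \<or> k = j then 1 else 0))"
    using assms by (simp add: scalar_prod_def ones_col_mat_def lessThan_atLeast0)
  also have "\<dots> = (if j = 0 then \<Sum>k<n. A $$ (i, k) else A $$ (i, j))"
    using j by (auto simp: if_distrib[of "\<lambda>x. _ * x"] cong: if_cong)
  finally show ?thesis .
qed

lemma ones_col_mat_inverse:
  "ones_col_mat n * ones_col_mat_inv n = 1\<^sub>m n"
  "ones_col_mat_inv n * ones_col_mat n = 1\<^sub>m n"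
proof -
  show "ones_col_mat n * ones_col_mat_inv n = 1\<^sub>m n"
    by (intro eq_matI)
      (auto simp: index_ones_col_mat_mult[where nc = n] ones_col_mat_inv_def simp del: index_mult_mat(1))
  show "ones_col_mat_inv n * ones_col_mat n = 1\<^sub>m n"
    by (intro eq_matI)
      (auto simp: index_ones_col_mat_inv_mult[where nc = n] ones_col_mat_def simp del: index_mult_mat(1))
qed

text \<open>In the basis given by \<open>ones_col_mat\<close> the first column becomes zero, because
  \<open>A\<close> annihilates the all-ones vector. The matrix is then block triangular.\<close>

lemma char_poly_reduced_mat:
  fixes A :: "'a :: idom mat"
  assumes A: "A \<in> carrier_mat (Suc N) (Suc N)"
    and row_sum: "\<And>i. i < Suc N \<Longrightarrow> (\<Sum>j<Suc N. A $$ (i, j)) = 0"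
  shows "char_poly A = [:0, 1:] * char_poly (reduced_mat A)"
proof -
  let ?n = "Suc N"
  let ?P = "ones_col_mat ?n :: 'a mat" and ?Q = "ones_col_mat_inv ?n :: 'a mat"
  define B where "B = four_block_mat (0\<^sub>m 1 1) (mat 1 N (\<lambda>(i, j). A $$ (0, Suc j)))
    (0\<^sub>m N 1) (reduced_mat A)"
  have red: "reduced_mat A \<in> carrier_mat N N" using A by (simp add: reduced_mat_def)
  have B: "B \<in> carrier_mat ?n ?n" using red four_block_carrier_mat[of "0\<^sub>m 1 1" 1 1 "reduced_mat A" N N] by (simp add: B_def)
  have index_B: "B $$ (i, j) = (if j = 0 then 0 else if i = 0 then A $$ (0, j)
      else A $$ (i, j) - A $$ (0, j))" if "i < ?n" "j < ?n" for i j
    using that A red by (simp add: B_def) (auto simp: reduced_mat_def)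
  \<comment> \<open>Similarity is checked in this form so that each entry involves only one product
    with \<open>?P\<close>.\<close>
  have "?P * B = A * ?P"
    using A B row_sum
    by (intro eq_matI) (auto simp: index_ones_col_mat_mult[where nc = ?n] index_B
        index_mult_ones_col_mat[where nr = ?n] simp del: index_mult_mat(1))
  then have "?P * B * ?Q = A * (?P * ?Q)"
    using A by (simp add: assoc_mult_mat[of A ?n ?n ?P ?n ?Q ?n])
  then have "A = ?P * B * ?Q" using A by (simp add: ones_col_mat_inverse)
  then have "similar_mat A B"
    using A B by (intro similar_matI[of _ _ ?P ?Q ?n]) (auto simp: ones_col_mat_inverse)
  then have "char_poly A = char_poly B" by (rule char_poly_similar)
  also have "\<dots> = char_poly (0\<^sub>m 1 1) * char_poly (reduced_mat A)"
    unfolding B_def by (rule char_poly_four_block_zeros_col) (use red in auto)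
  also have "char_poly (0\<^sub>m 1 1) = ([:0, 1:] :: 'a poly)"
    by (subst char_poly_upper_triangular[of _ 1]) (auto simp: diag_mat_def)
  finally show ?thesis .
qed

section \<open>Eigenvalue sums and traces\<close>

lemma proots_prod_list_linear:
  "proots (\<Prod>a\<leftarrow>xs. [:- a, 1:]) = mset xs" for xs :: "'a :: idom list"
proof (induction xs)
  case (Cons a xs)
  have "(\<Prod>a\<leftarrow>xs. [:- a, 1:]) \<noteq> 0" by (auto simp: prod_list_zero_iff)
  then have "proots ([:- a, 1:] * (\<Prod>a\<leftarrow>xs. [:- a, 1:])) = {#a#} + mset xs"
    by (subst proots_mult) (simp_all add: Cons.IH)
  then show ?case by simp
qed simp

text \<open>Schur triangularization puts the eigenvalues on a diagonal, and similarity preserves the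
  trace because \<open>X * Y\<close> and \<open>Y * X\<close> have equal traces.\<close>

lemma sum_mset_proots_char_poly:
  fixes A :: "complex mat"
  assumes A: "A \<in> carrier_mat n n"
  shows "(\<Sum>z\<in>#proots (char_poly A). z) = (\<Sum>i<n. A $$ (i, i))"
proof -
  have trace_comm: "(\<Sum>i<n. (X * Y) $$ (i, i)) = (\<Sum>i<n. (Y * X) $$ (i, i))"
    if "X \<in> carrier_mat n n" "Y \<in> carrier_mat n n" for X Y :: "complex mat"
  proof -
    have "(\<Sum>i<n. (X * Y) $$ (i, i)) = (\<Sum>i<n. \<Sum>j<n. X $$ (i, j) * Y $$ (j, i))"
      using that by (simp add: scalar_prod_def lessThan_atLeast0)
    also have "\<dots> = (\<Sum>j<n. \<Sum>i<n. Y $$ (j, i) * X $$ (i, j))"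
      by (subst sum.swap) (simp add: mult.commute)
    also have "\<dots> = (\<Sum>i<n. (Y * X) $$ (i, i))"
      using that by (simp add: scalar_prod_def lessThan_atLeast0)
    finally show ?thesis .
  qed
  obtain es where "char_poly A = (\<Prod>a\<leftarrow>es. [:- a, 1:])"
    using char_poly_factorized[OF A] by blast
  then obtain B where B: "B \<in> carrier_mat n n" "upper_triangular B" "similar_mat A B"
    using schur_decomposition_exists[OF A] by blast
  from similar_matD[OF B(3)] obtain n' P Q where
    *: "{A, B, P, Q} \<subseteq> carrier_mat n' n'" "Q * P = 1\<^sub>m n'" "A = P * B * Q"
    by blast
  then have [simp]: "n' = n" using A by auto
  have "char_poly A = (\<Prod>a\<leftarrow>diag_mat B. [:- a, 1:])"
    using char_poly_similar[OF B(3)] char_poly_upper_triangular[OF B(1,2)] by simp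
  then have "proots (char_poly A) = mset (diag_mat B)"
    by (simp add: proots_prod_list_linear)
  then have "(\<Sum>z\<in>#proots (char_poly A). z) = (\<Sum>i<n. B $$ (i, i))"
    using B(1) by (simp add: diag_mat_def lessThan_atLeast0 sum_unfold_sum_mset)
  \<comment> \<open>In this bracketing, swapping the two factors yields \<open>P * B * Q\<close>,
    which is \<open>A\<close>.\<close>
  also have "B = Q * (P * B)"
    using * B(1) by (simp flip: assoc_mult_mat[of Q n n P n B n])
  also have "(\<Sum>i<n. (Q * (P * B)) $$ (i, i)) = (\<Sum>i<n. A $$ (i, i))"
    using * by (subst trace_comm) auto
  finally show ?thesis .
qed

subsection \<open>The Laplacian\<close>

text \<open>The indicator sum is a row sum of \<open>adjacency_mat\<close>, ready to cancel against
  the diagonal of the Laplacian.\<close>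

lemma in_degree_simple_digraph:
  assumes "G \<in> simple_digraphs n m"
  shows "in_degree (with_proj G) i = card {j. (j, i) \<in> parcs G}"
    and "in_degree (with_proj G) i = (\<Sum>j<n. if (j, i) \<in> parcs G then 1 else 0)"
proof -
  interpret pair_digraph G using assms by (simp add: simple_digraphs_def)
  have "in_arcs (with_proj G) i = (\<lambda>j. (j, i)) ` {j. (j, i) \<in> parcs G}"
    by (auto simp: in_arcs_def)
  then show 1: "in_degree (with_proj G) i = card {j. (j, i) \<in> parcs G}"
    by (simp add: in_degree_def card_image inj_on_def)
  have "{j. (j, i) \<in> parcs G} = {j \<in> {..<n}. (j, i) \<in> parcs G}"
    using assms in_arcsD1 by (auto simp: simple_digraphs_def)
  then show "in_degree (with_proj G) i = (\<Sum>j<n. if (j, i) \<in> parcs G then 1 else 0)"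
    unfolding 1 by (simp add: sum.If_cases Int_def)
qed

lemma sum_in_degree:
  assumes "G \<in> simple_digraphs n m"
  shows "(\<Sum>i<n. in_degree (with_proj G) i) = m"
proof -
  interpret pair_digraph G using assms by (simp add: simple_digraphs_def)
  have "(\<Sum>i<n. \<Sum>e | e \<in> parcs G \<and> snd e = i. 1) = (\<Sum>e\<in>parcs G. 1 :: nat)"
    using assms by (intro sum.group) (auto simp: simple_digraphs_def dest: in_arcsD2)
  then show ?thesis
    using assms by (simp add: simple_digraphs_def in_degree_def in_arcs_def)
qed

lemma laplacian_carrier [simp]: "laplacian n G \<in> carrier_mat n n"
  unfolding laplacian_def in_degree_mat_def adjacency_mat_def by (intro minus_carrier_mat mat_carrier)

lemma index_laplacian:
  assumes "i < n" "j < n"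
  shows "laplacian n G $$ (i, j) = (if i = j then of_nat (in_degree (with_proj G) i) else 0)
    - (if (j, i) \<in> parcs G then 1 else 0)"
  using assms by (simp add: laplacian_def in_degree_mat_def adjacency_mat_def)

lemma laplacian_row_sum:
  assumes "G \<in> simple_digraphs n m" "i < n"
  shows "(\<Sum>j<n. laplacian n G $$ (i, j)) = 0"
  using assms(2) by (simp add: index_laplacian sum_subtractf in_degree_simple_digraph(2)[OF assms(1)] of_nat_sum if_distrib[of of_nat] cong: if_cong)

lemma laplacian_trace:
  assumes "G \<in> simple_digraphs n m"
  shows "(\<Sum>i<n. laplacian n G $$ (i, i)) = of_nat m"
proof -
  interpret pair_digraph G using assms by (simp add: simple_digraphs_def)
  have "(i, i) \<notin> parcs G" for i using pair_no_loops by force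
  then have "(\<Sum>i<n. laplacian n G $$ (i, i)) = of_nat (\<Sum>i<n. in_degree (with_proj G) i)"
    by (simp add: index_laplacian)
  then show ?thesis using sum_in_degree[OF assms] by simp
qed

lemma char_poly_laplacian:
  assumes "G \<in> simple_digraphs n m" "n \<ge> 1"
  shows "char_poly (laplacian n G) = [:0, 1:] * char_poly (reduced_mat (laplacian n G))"
proof (rule char_poly_reduced_mat)
  show "laplacian n G \<in> carrier_mat (Suc (n - 1)) (Suc (n - 1))" using assms(2) by simp
qed (use assms laplacian_row_sum[OF assms(1)] in auto)

lemma reduced_laplacian_carrier [simp]:
  "reduced_mat (laplacian n G) \<in> carrier_mat (n - 1) (n - 1)"
  using laplacian_carrier[of n G] by (simp add: reduced_mat_def carrier_matD(1)[OF laplacian_carrier])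

text \<open>The linear factor of the characteristic polynomial supplies the 0 that
  \<open>nontrivial_spectrum\<close> removes, so the multiset difference loses exactly one
  element.\<close>

lemma laplacian_spectrum_eq:
  assumes "G \<in> simple_digraphs n m" "n \<ge> 1"
  shows "nontrivial_spectrum n G = proots (char_poly (reduced_mat (laplacian n G)))"
    and "laplacian_spectrum n G = {#0#} + nontrivial_spectrum n G"
proof -
  have "char_poly (reduced_mat (laplacian n G)) \<noteq> 0"
    using degree_monic_char_poly[OF reduced_laplacian_carrier[of n G]] by auto
  then have *: "laplacian_spectrum n G = {#0#} + proots (char_poly (reduced_mat (laplacian n G)))"
    unfolding laplacian_spectrum_def char_poly_laplacian[OF assms]
    by (subst proots_mult) auto
  then show "nontrivial_spectrum n G = proots (char_poly (reduced_mat (laplacian n G)))"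
    by (simp add: nontrivial_spectrum_def)
  with * show "laplacian_spectrum n G = {#0#} + nontrivial_spectrum n G" by simp
qed

lemma nontrivial_spectrum_size_sum:
  assumes "G \<in> simple_digraphs n m" "n \<ge> 1"
  shows "size (nontrivial_spectrum n G) = n - 1"
    and "(\<Sum>z\<in>#nontrivial_spectrum n G. z) = of_nat m"
proof -
  show "size (nontrivial_spectrum n G) = n - 1"
    using degree_monic_char_poly[OF reduced_laplacian_carrier[of n G]]
    by (simp add: laplacian_spectrum_eq(1)[OF assms] size_proots_complex)
  have "(\<Sum>z\<in>#laplacian_spectrum n G. z) = of_nat m"
    using sum_mset_proots_char_poly[OF laplacian_carrier[of n G]] laplacian_trace[OF assms(1)]
    by (simp add: laplacian_spectrum_def)
  then show "(\<Sum>z\<in>#nontrivial_spectrum n G. z) = of_nat m"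
    by (simp add: laplacian_spectrum_eq(2)[OF assms])
qed

text \<open>The reduced Laplacian has integer entries, hence a monic integer characteristic
  polynomial.\<close>

lemma nontrivial_spectrum_int_poly:
  assumes "G \<in> simple_digraphs n m" "n \<ge> 1"
  obtains p :: "int poly" where "lead_coeff p = 1"
    "nontrivial_spectrum n G = proots (map_poly of_int p)"
proof -
  \<comment> \<open>The floor of the real part only changes the type: it is exact on integer
    entries.\<close>
  define M :: "int mat" where "M = mat (n - 1) (n - 1) (\<lambda>(i, j). \<lfloor>Re (reduced_mat (laplacian n G) $$ (i, j))\<rfloor>)"
  have M: "M \<in> carrier_mat (n - 1) (n - 1)" by (simp add: M_def)
  have "laplacian n G $$ (i, j) \<in> \<int>" if "i < n" "j < n" for i j
    using that by (simp add: index_laplacian)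
  then have "reduced_mat (laplacian n G) $$ (i, j) \<in> \<int>" if "i < n - 1" "j < n - 1" for i j
    using that by (auto simp: reduced_mat_def carrier_matD(1)[OF laplacian_carrier] intro!: Ints_diff)
  moreover have "of_int \<lfloor>Re x\<rfloor> = x" if "x \<in> \<int>" for x
    using that by (elim Ints_cases) simp
  ultimately have "reduced_mat (laplacian n G) = map_mat of_int M"
    using reduced_laplacian_carrier[of n G] by (intro eq_matI) (auto simp: M_def)
  then have "char_poly (reduced_mat (laplacian n G)) = map_poly of_int (char_poly M)"
    using of_int_hom.char_poly_hom[OF M] by metis
  then show thesis
    using that[of "char_poly M"] degree_monic_char_poly[OF M] laplacian_spectrum_eq(1)[OF assms] by simp
qed

section \<open>Spread about the mean in terms of the excess\<close>

lemma sum_mset_spread: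
  fixes S :: "complex multiset" and k s N c :: real
  assumes "N = size S" "N > 0" "(\<Sum>z\<in>#S. z) = of_real s"
  defines "c \<equiv> s / N"
  shows "(\<Sum>z\<in>#S. (cmod (z - of_real c))\<^sup>2) / N =
    1 / N\<^sup>2 * (s - N * k) * (N * (k + 1) - s)
    + (\<Sum>z\<in>#S. (cmod (z - of_real k))\<^sup>2 - Re (z - of_real k)) / N"
    (is "_ = _ + (\<Sum>z\<in>#S. ?e z) / N")
proof -
  define d where "d = c - k"
  have Re_sum: "(\<Sum>z\<in>#T. Re z) = Re (\<Sum>z\<in>#T. z)" for T
    by (induction T) auto
  have s: "s = N * (d + k)" using assms(2) by (simp add: d_def c_def)
  have sum_affine: "(\<Sum>z\<in>#T. f z + a * (Re z - k) + b) =
      (\<Sum>z\<in>#T. f z) + a * ((\<Sum>z\<in>#T. Re z) - size T * k) + size T * b"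
    for f :: "complex \<Rightarrow> real" and a b :: real and T
    by (induction T) (auto simp: algebra_simps)
  \<comment> \<open>Recentring at \<open>k\<close> gives the coefficient \<open>-2 * d\<close>; the
    extra 1 restores the real part subtracted in the excess. The linear terms sum to
    \<open>N * d * (1 - 2 * d)\<close>.\<close>
  have "(cmod (z - of_real c))\<^sup>2 = ?e z + (1 - 2 * d) * (Re z - k) + d\<^sup>2" for z
    unfolding cmod_power2 by (simp add: d_def power2_eq_square algebra_simps)
  then have "(\<Sum>z\<in>#S. (cmod (z - of_real c))\<^sup>2) =
      (\<Sum>z\<in>#S. ?e z) + (1 - 2 * d) * (s - N * k) + N * d\<^sup>2"
    by (simp only: sum_affine Re_sum assms(3) assms(1)[symmetric] Re_complex_of_real)
  also have "\<dots> = (\<Sum>z\<in>#S. ?e z) + N * (d * (1 - d))"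
    by (simp add: s power2_eq_square algebra_simps)
  also have "\<dots> / N = (\<Sum>z\<in>#S. ?e z) / N + d * (1 - d)"
    using assms(2) by (simp add: add_divide_distrib)
  also have "d * (1 - d) = 1 / N\<^sup>2 * (s - N * k) * (N * (k + 1) - s)"
    using assms(2) by (simp add: s power2_eq_square field_simps)
  finally show ?thesis by simp
qed

subsection \<open>Optimal digraphs\<close>

text \<open>The hubs are the vertices \<open>1, \<dots>, k\<close>; vertex \<open>0\<close> supplies the \<open>r\<close> additional arcs.\<close>
definition hub_digraph :: "nat \<Rightarrow> nat \<Rightarrow> nat \<Rightarrow> nat pair_pre_digraph" where
  "hub_digraph n k r = \<lparr>pverts = {0..<n},
     parcs = {(j, i). i < n \<and> j < n \<and> i \<noteq> j \<and> (1 \<le> j \<and> j \<le> k \<or> j = 0 \<and> i \<le> r)}\<rparr>"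

lemma parcs_hub_digraph:
  "(j, i) \<in> parcs (hub_digraph n k r) \<longleftrightarrow>
     i < n \<and> j < n \<and> i \<noteq> j \<and> (1 \<le> j \<and> j \<le> k \<or> j = 0 \<and> i \<le> r)"
  by (simp add: hub_digraph_def)

lemma hub_digraph_simple:
  "hub_digraph n k r \<in> simple_digraphs n (card (parcs (hub_digraph n k r)))"
proof -
  have "parcs (hub_digraph n k r) \<subseteq> {..<n} \<times> {..<n}" by (auto simp: hub_digraph_def)
  then have "finite (parcs (hub_digraph n k r))" by (rule finite_subset) simp
  then have "pair_digraph (hub_digraph n k r)"
    by unfold_locales (auto simp: hub_digraph_def)
  then show ?thesis by (simp add: simple_digraphs_def hub_digraph_def)
qed

text \<open>Off the diagonal, subtracting row 0 cancels everything: a hub points both to vertex 0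
  and to each other vertex, and the column of vertex 0 has been dropped.\<close>

lemma nontrivial_spectrum_hub_digraph:
  assumes "n \<ge> 1" "k \<le> n - 1" "r \<le> n - 1"
  shows "nontrivial_spectrum n (hub_digraph n k r) =
    replicate_mset r (of_nat (k + 1)) + replicate_mset (n - 1 - r) (of_nat k)"
proof -
  let ?G = "hub_digraph n k r"
  let ?M = "reduced_mat (laplacian n ?G)"
  let ?d = "\<lambda>i. of_nat (k + (if i < r then 1 else 0)) :: complex"
  \<comment> \<open>A hub has no arc to itself, so its in-degree is one short; its arc to vertex 0
    restores this 1 when row 0 is subtracted.\<close>
  have deg: "in_degree (with_proj ?G) (Suc i) + (if Suc i \<le> k then 1 else 0) =
      k + (if i < r then 1 else 0)" if "i < n - 1" for i
  proof -
    have "{j. (j, Suc i) \<in> parcs ?G} = ({1..k} - {Suc i}) \<union> (if i < r then {0} else {})"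
      using assms that by (auto simp: parcs_hub_digraph)
    then show ?thesis
      unfolding in_degree_simple_digraph(1)[OF hub_digraph_simple] by (auto simp: card_Diff_singleton_if)
  qed
  have index_M: "?M $$ (i, j) = (if i = j then ?d i else 0)" if "i < n - 1" "j < n - 1" for i j
  proof (cases "i = j")
    case True
    have "?M $$ (i, i) = of_nat (in_degree (with_proj ?G) (Suc i) + (if Suc i \<le> k then 1 else 0))"
      using that by (simp add: reduced_mat_def carrier_matD(1)[OF laplacian_carrier]
          index_laplacian parcs_hub_digraph)
    then show ?thesis using deg that True by simp
  next
    case False
    then show ?thesis
      using that by (simp add: reduced_mat_def carrier_matD(1)[OF laplacian_carrier]
          index_laplacian parcs_hub_digraph)
  qed
  have dim: "dim_row ?M = n - 1" using reduced_laplacian_carrier by blast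
  have "upper_triangular ?M"
    using index_M dim by (auto simp: upper_triangular_def)
  then have "proots (char_poly ?M) = mset (diag_mat ?M)"
    by (simp add: char_poly_upper_triangular[OF reduced_laplacian_carrier] proots_prod_list_linear)
  also have "diag_mat ?M = map ?d [0..<n - 1]"
    using index_M dim by (simp add: diag_mat_def)
  also have "[0..<n - 1] = [0..<r] @ [r..<n - 1]"
    using assms(3) by (metis le_add_diff_inverse upt_add_eq_append zero_le)
  also have "mset (map ?d ([0..<r] @ [r..<n - 1])) =
      mset (map (\<lambda>_. of_nat (k + 1)) [0..<r]) + mset (map (\<lambda>_. of_nat k) [r..<n - 1])"
    unfolding map_append mset_append
    by (intro arg_cong2[of _ _ _ _ "(+)"] arg_cong[of _ _ mset] map_cong) auto
  also have "\<dots> = replicate_mset r (of_nat (k + 1)) + replicate_mset (n - 1 - r) (of_nat k)"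
    unfolding map_replicate_const mset_replicate by simp
  finally show ?thesis
    using laplacian_spectrum_eq(1)[OF hub_digraph_simple assms(1)] by simp
qed

lemma hub_digraph_arcs:
  assumes "n \<ge> 1" "k \<le> n - 1" "r \<le> n - 1"
  shows "hub_digraph n k r \<in> simple_digraphs n ((n - 1) * k + r)"
proof -
  \<comment> \<open>The arcs are counted by the trace, so the known spectrum gives their number.\<close>
  have "of_nat (card (parcs (hub_digraph n k r))) =
      (\<Sum>z\<in>#nontrivial_spectrum n (hub_digraph n k r). z)"
    using nontrivial_spectrum_size_sum(2)[OF hub_digraph_simple assms(1)] by simp
  also have "\<dots> = of_nat (r * (k + 1) + (n - 1 - r) * k)"
    by (simp add: nontrivial_spectrum_hub_digraph[OF assms] distrib_left)
  also have "r * (k + 1) + (n - 1 - r) * k = (n - 1) * k + r"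
  proof -
    obtain q where "n - 1 = r + q" using le_Suc_ex[OF assms(3)] by blast
    then show ?thesis by (simp add: algebra_simps)
  qed
  finally have "card (parcs (hub_digraph n k r)) = (n - 1) * k + r"
    by (simp only: of_nat_eq_iff)
  then show ?thesis using hub_digraph_simple[of n k r] by simp
qed

text \<open>Except for the complete digraph, division with remainder of \<open>m\<close> by
  \<open>n - 1\<close> gives the number of hubs and of additional arcs.\<close>

lemma ex_two_values_nontrivial_spectrum:
  assumes "n \<ge> 2" "m \<le> n * (n - 1)" "k = m div (n - 1)"
  shows "\<exists>G\<in>simple_digraphs n m. \<forall>z\<in>#nontrivial_spectrum n G. z = of_nat k \<or> z = of_nat (k + 1)"
proof (cases "m = n * (n - 1)")
  case True
  then have "k = n" using assms by simp
  have "m = (n - 1) * (n - 1) + (n - 1)" using True assms(1) by (cases n) auto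
  \<comment> \<open>Here \<open>k = n\<close> leaves no vertex outside the hubs, so use \<open>n - 1\<close> hubs and \<open>n - 1\<close> additional arcs.\<close>
  then have "hub_digraph n (n - 1) (n - 1) \<in> simple_digraphs n m"
    using hub_digraph_arcs[of n "n - 1" "n - 1"] assms(1) by simp
  moreover have "nontrivial_spectrum n (hub_digraph n (n - 1) (n - 1)) = replicate_mset (n - 1) (of_nat k)"
    using nontrivial_spectrum_hub_digraph[of n "n - 1" "n - 1"] assms(1) \<open>k = n\<close> by simp
  ultimately show ?thesis by (intro bexI) (auto split: if_splits)
next
  case False
  then have "m < n * (n - 1)" using assms(2) by simp
  then have "k < n" using assms(3) by (simp add: less_mult_imp_div_less)
  let ?r = "m mod (n - 1)"
  have r: "?r \<le> n - 1" using assms(1) by (simp add: less_imp_le)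
  have "(n - 1) * k + ?r = m" unfolding assms(3) by simp
  then have "hub_digraph n k ?r \<in> simple_digraphs n m"
    using hub_digraph_arcs[of n k ?r] r assms(1) \<open>k < n\<close> by simp
  moreover have "nontrivial_spectrum n (hub_digraph n k ?r) =
      replicate_mset ?r (of_nat (k + 1)) + replicate_mset (n - 1 - ?r) (of_nat k)"
    using nontrivial_spectrum_hub_digraph[of n k ?r] r assms(1) \<open>k < n\<close> by simp
  ultimately show ?thesis by (intro bexI) (auto split: if_splits)
qed

section \<open>The minimal spread and its equality case\<close>

theorem theorem1:
  fixes n m \<kappa> :: nat and \<sigma>2min :: real
  assumes "n \<ge> 2" and "m \<le> n * (n - 1)"
  defines "\<kappa> \<equiv> nat \<lfloor>real m / (real n - 1)\<rfloor>"
  defines "\<sigma>2min \<equiv> 1 / (real n - 1)\<^sup>2 * (real m - (real n - 1) * real \<kappa>)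
                        * ((real n - 1) * (real \<kappa> + 1) - real m)"
  shows "(\<exists>G\<in>simple_digraphs n m. normalized_spread n G = \<sigma>2min)
       \<and> (\<forall>G\<in>simple_digraphs n m. \<sigma>2min \<le> normalized_spread n G)
       \<and> (\<forall>G\<in>simple_digraphs n m. normalized_spread n G = \<sigma>2min \<longleftrightarrow>
            laplacian_spectrum n G =
              {#0#} + replicate_mset ((n - 1) * (\<kappa> + 1) - m) (of_nat \<kappa>)
                    + replicate_mset (m - (n - 1) * \<kappa>) (of_nat (\<kappa> + 1)))"
proof -
  let ?N = "real n - 1"
  let ?S = "nontrivial_spectrum n"
  let ?two = "\<lambda>G. \<forall>z\<in>#?S G. z = of_nat \<kappa> \<or> z = of_nat (\<kappa> + 1)"
  let ?e = "\<lambda>z. (cmod (z - of_nat \<kappa>))\<^sup>2 - Re (z - of_nat \<kappa>)"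
  have n: "n \<ge> 1" and N: "?N = real (n - 1)" "?N > 0" using assms(1) by auto
  have \<kappa>: "\<kappa> = m div (n - 1)"
    unfolding \<kappa>_def N(1) by (simp add: floor_divide_of_nat_eq)
  \<comment> \<open>The term independent of the individual eigenvalues is exactly
    \<open>\<sigma>2min\<close>, so only the mean excess depends on \<open>G\<close>.\<close>
  have spread: "normalized_spread n G = \<sigma>2min + (\<Sum>z\<in>#?S G. ?e z) / ?N"
    if G: "G \<in> simple_digraphs n m" for G
  proof -
    have mean: "mean_eigenvalue n G = of_real (real m / ?N)"
      using nontrivial_spectrum_size_sum(2)[OF G n] by (simp add: mean_eigenvalue_def)
    have size: "?N = size (?S G)" unfolding N(1) nontrivial_spectrum_size_sum(1)[OF G n] ..
    have sum: "(\<Sum>z\<in>#?S G. z) = of_real (real m)"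
      using nontrivial_spectrum_size_sum(2)[OF G n] by simp
    show ?thesis
      using sum_mset_spread[OF size N(2) sum, of "real \<kappa>"]
      unfolding normalized_spread_def \<sigma>2min_def mean of_real_of_nat_eq .
  qed
  have excess: "0 \<le> (\<Sum>z\<in>#?S G. ?e z)" "(\<Sum>z\<in>#?S G. ?e z) = 0 \<longleftrightarrow> ?two G"
    if G: "G \<in> simple_digraphs n m" for G
  proof -
    obtain p :: "int poly" where p: "lead_coeff p = 1" "?S G = proots (map_poly of_int p)"
      using nontrivial_spectrum_int_poly[OF G n] by blast
    show "0 \<le> (\<Sum>z\<in>#?S G. ?e z)" "(\<Sum>z\<in>#?S G. ?e z) = 0 \<longleftrightarrow> ?two G"
      using int_poly_excess[OF p(1), of "int \<kappa>"] unfolding p(2) by (simp_all add: add.commute)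
  qed
  have lower: "\<sigma>2min \<le> normalized_spread n G" if "G \<in> simple_digraphs n m" for G
    using spread[OF that] excess(1)[OF that] N(2) by simp
  have min_iff: "normalized_spread n G = \<sigma>2min \<longleftrightarrow> ?two G" if "G \<in> simple_digraphs n m" for G
    using spread[OF that] excess(2)[OF that] N(2) by simp
  have two_iff: "?two G \<longleftrightarrow> laplacian_spectrum n G =
      {#0#} + replicate_mset ((n - 1) * (\<kappa> + 1) - m) (of_nat \<kappa>)
            + replicate_mset (m - (n - 1) * \<kappa>) (of_nat (\<kappa> + 1))" (is "_ \<longleftrightarrow> _ = {#0#} + ?A + ?B")
    if G: "G \<in> simple_digraphs n m" for G
  proof
    assume "?two G"
    then have "?S G = ?A + ?B"
      by (rule sum_two_values) (use nontrivial_spectrum_size_sum[OF G n] in auto)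
    then show "laplacian_spectrum n G = {#0#} + ?A + ?B"
      using laplacian_spectrum_eq(2)[OF G n] by simp
  next
    assume "laplacian_spectrum n G = {#0#} + ?A + ?B"
    \<comment> \<open>Only one copy of 0 is cancelled; for \<open>\<kappa> = 0\<close> any further
      zeros belong to \<open>?A\<close>.\<close>
    then have "?S G = ?A + ?B" using laplacian_spectrum_eq(2)[OF G n] by simp
    then show "?two G" by (auto split: if_splits)
  qed
  show ?thesis
    using lower min_iff two_iff ex_two_values_nontrivial_spectrum[OF assms(1,2) \<kappa>] by blast
qed

end
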